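(* Let $m,n\ge 2$ be integers, let $\mathbb{K}$ be a field and let $S=\mathbb{K}[x_{i,j}: i\in[m], j\in[n]]$. Let $\tau$ be the lexicographic order on $S$ induced by $x_{1,1}>x_{1,2}>\cdots>x_{1,n}>x_{2,1}>\cdots>x_{2,n}>\cdots>x_{m,1}>\cdots>x_{m,n}$. Let $\mathcal{J}_{K_m,P_n}\subseteq S$ be the ideal generated by the $2$-minors $[i,j\,|\,k,k+1]=x_{i,k}x_{j,k+1}-x_{i,k+1}x_{j,k}$ for $1\le i<j\le m$ and $k\in[n-1]$. Then $(\operatorname{in}_\tau(\mathcal{J}_{K_m,P_n}))^t=\operatorname{in}_\tau(\mathcal{J}_{K_m,P_n}^t)$ for all $t\ge 1$.
   Context: $\mathcal{J}_{K_m,P_n}$ is the generalized binomial edge ideal of the path graph $P_n$ on $[n]$ with edges $\{k,k+1\}$. $\operatorname{in}_\tau(I)$ denotes the initial ideal of $I$ with respect to $\tau$. *)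

theory Defs
  imports Main "HOL-Library.Poly_Mapping"
begin

text \<open>Variables x_{i,j} are indexed by pairs (i,j) of naturals; monomials are exponent
vectors over the variables; polynomials over 'k are finitely supported maps from
monomials to coefficients (multiplication = convolution from Poly_Mapping).\<close>

type_synonym monom = "(nat \<times> nat) \<Rightarrow>\<^sub>0 nat"
type_synonym 'k mpoly = "monom \<Rightarrow>\<^sub>0 'k"

definition var :: "nat \<Rightarrow> nat \<Rightarrow> 'k::comm_ring_1 mpoly" where
  "var i j = Poly_Mapping.single (Poly_Mapping.single (i, j) 1) 1"

definition monom_poly :: "monom \<Rightarrow> 'k::comm_ring_1 mpoly" where
  "monom_poly \<alpha> = Poly_Mapping.single \<alpha> 1"

definition polyring :: "nat \<Rightarrow> nat \<Rightarrow> 'k::comm_ring_1 mpoly set" where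
  "polyring m n = {p. \<forall>\<alpha>\<in>Poly_Mapping.keys p. Poly_Mapping.keys \<alpha> \<subseteq> ({1..m} \<times> {1..n})}"

definition var_gt :: "nat \<times> nat \<Rightarrow> nat \<times> nat \<Rightarrow> bool" where
  "var_gt v w \<longleftrightarrow> fst v < fst w \<or> (fst v = fst w \<and> snd v < snd w)"

definition lex_less :: "monom \<Rightarrow> monom \<Rightarrow> bool" where
  "lex_less \<beta> \<alpha> \<longleftrightarrow>
     (\<exists>v. Poly_Mapping.lookup \<beta> v < Poly_Mapping.lookup \<alpha> v \<and> (\<forall>w. var_gt w v \<longrightarrow> Poly_Mapping.lookup \<beta> w = Poly_Mapping.lookup \<alpha> w))"

definition lead_mon :: "'k::comm_ring_1 mpoly \<Rightarrow> monom" where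
  "lead_mon p = (THE \<alpha>. \<alpha> \<in> Poly_Mapping.keys p \<and> (\<forall>\<beta>\<in>Poly_Mapping.keys p. \<beta> \<noteq> \<alpha> \<longrightarrow> lex_less \<beta> \<alpha>))"

definition ideal_gen :: "'a::comm_ring_1 set \<Rightarrow> 'a set \<Rightarrow> 'a set" where
  "ideal_gen R G = {\<Sum>g\<in>F. c g * g | F c. finite F \<and> F \<subseteq> G \<and> (\<forall>g\<in>F. c g \<in> R)}"

definition ideal_pow :: "'a::comm_ring_1 set \<Rightarrow> 'a set \<Rightarrow> nat \<Rightarrow> 'a set" where
  "ideal_pow R I t = ideal_gen R {prod_list ps | ps. length ps = t \<and> set ps \<subseteq> I}"

definition init_ideal :: "'k::comm_ring_1 mpoly set \<Rightarrow> 'k mpoly set \<Rightarrow> 'k mpoly set" where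
  "init_ideal R I = ideal_gen R {monom_poly (lead_mon f) | f. f \<in> I \<and> f \<noteq> 0}"

definition minor2 :: "nat \<Rightarrow> nat \<Rightarrow> nat \<Rightarrow> nat \<Rightarrow> 'k::comm_ring_1 mpoly" where
  "minor2 i j k l = var i k * var j l - var i l * var j k"

definition J_KmPn :: "nat \<Rightarrow> nat \<Rightarrow> 'k::comm_ring_1 mpoly set" where
  "J_KmPn m n = ideal_gen (polyring m n)
     {minor2 i j k (k + 1) | i j k. 1 \<le> i \<and> i < j \<and> j \<le> m \<and> 1 \<le> k \<and> k \<le> n - 1}"

end

theory Submission
  imports Defs "HOL-Library.Product_Lexorder" "HOL-Library.Product_Plus" "HOL-Library.Function_Algebras"
begin

text \<open>
  The leading monomials \<open>x\<^sub>i\<^sub>,\<^sub>k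
  x\<^sub>j\<^sub>,\<^sub>k\<^sub>+\<^sub>1\<close> (i < j) of the generators are the edges of a
  graph on the variables that is bipartite by the parity of the column. By a weighted form of
  Koenig's theorem a monomial is divisible by a product of t edges as soon as its degree in the
  variables of each vertex cover C is at least t. So it suffices to bound the degree in C of the
  leading monomial of every nonzero element f of the t-th power of the ideal.

  Let P be the complement of C, and call a column empty if it does not meet P. Substitute
  \<open>x\<^sub>i\<^sub>,\<^sub>k \<mapsto> u\<^sub>i\<^sub>,\<^sub>r v\<^sub>k +
  y\<^sub>i\<^sub>,\<^sub>k\<close>, where r numbers the maximal run of nonempty columns containing
  k, the first summand is dropped in empty columns and the second outside C. All generators are
  mapped into the ideal generated by the y, so every term of the image of f has degree at least t in
  y. Write the leading monomial of f as a b with a supported on P and b on C. Because P descends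
  from left to right inside each run, a is the lexicographically smallest monomial with its row and
  column margins; hence no other monomial of f contributes to the term of the image of f belonging
  to (a, b), and this term survives. Its degree in y is the degree of the leading monomial in C.
\<close>

section \<open>Generated ideals\<close>

lemma ideal_gen_induct [consumes 1, case_names zero add smult]:
  assumes "x \<in> ideal_gen R G"
    and "P 0" and "\<And>x y. P x \<Longrightarrow> P y \<Longrightarrow> P (x + y)" and "\<And>r g. r \<in> R \<Longrightarrow> g \<in> G \<Longrightarrow> P (r * g)"
  shows "P x"
proof -
  obtain F c where x: "x = (\<Sum>g\<in>F. c g * g)" and F: "finite F" "F \<subseteq> G" "\<forall>g\<in>F. c g \<in> R"
    using assms(1) by (auto simp: ideal_gen_def)
  from F have "P (\<Sum>g\<in>F. c g * g)"
    by (induction F rule: finite_induct) (auto intro: assms)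
  with x show ?thesis by simp
qed

text \<open>\<open>polyring m n\<close> is a subset of the ring of polynomials in all variables, not
  a type of its own, so the ideal calculus is done relative to a coefficient set
  \<open>R\<close>.\<close>

locale coeff_ring =
  fixes R :: "'a::comm_ring_1 set"
  assumes zero_mem: "0 \<in> R" and one_mem: "1 \<in> R"
    and add_mem: "x \<in> R \<Longrightarrow> y \<in> R \<Longrightarrow> x + y \<in> R"
    and mult_mem: "x \<in> R \<Longrightarrow> y \<in> R \<Longrightarrow> x * y \<in> R"
begin

lemma ideal_gen_zero: "0 \<in> ideal_gen R G"
  unfolding ideal_gen_def by (auto intro!: exI[of _ "{}"])

lemma ideal_gen_base:
  assumes "g \<in> G" shows "g \<in> ideal_gen R G"
  unfolding ideal_gen_def using assms one_mem
  by (auto intro!: exI[of _ "{g}"] exI[of _ "\<lambda>_. 1"])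

lemma ideal_gen_add:
  assumes "x \<in> ideal_gen R G" "y \<in> ideal_gen R G"
  shows "x + y \<in> ideal_gen R G"
proof -
  obtain F c where x: "x = (\<Sum>g\<in>F. c g * g)" and F: "finite F" "F \<subseteq> G" "\<forall>g\<in>F. c g \<in> R"
    using assms(1) by (auto simp: ideal_gen_def)
  obtain F' d where y: "y = (\<Sum>g\<in>F'. d g * g)" and F': "finite F'" "F' \<subseteq> G" "\<forall>g\<in>F'. d g \<in> R"
    using assms(2) by (auto simp: ideal_gen_def)
  \<comment> \<open>A generator may occur in both sums but only once in the union, so both
    coefficient families are first extended by zero.\<close>
  define c' where "c' g = (if g \<in> F then c g else 0)" for g
  define d' where "d' g = (if g \<in> F' then d g else 0)" for g
  have "x = (\<Sum>g\<in>F \<union> F'. c' g * g)"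
    unfolding x by (rule sum.mono_neutral_cong_left) (use F F' in \<open>auto simp: c'_def\<close>)
  moreover have "y = (\<Sum>g\<in>F \<union> F'. d' g * g)"
    unfolding y by (rule sum.mono_neutral_cong_left) (use F F' in \<open>auto simp: d'_def\<close>)
  ultimately have "x + y = (\<Sum>g\<in>F \<union> F'. (c' g + d' g) * g)"
    by (simp add: sum.distrib distrib_right)
  moreover have "c' g + d' g \<in> R" for g
    using F F' by (auto simp: c'_def d'_def intro!: add_mem zero_mem)
  ultimately show ?thesis
    unfolding ideal_gen_def using F F'
    by (auto intro!: exI[of _ "F \<union> F'"] exI[of _ "\<lambda>g. c' g + d' g"])
qed

lemma ideal_gen_smult:
  assumes "x \<in> ideal_gen R G" "r \<in> R"
  shows "r * x \<in> ideal_gen R G"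
proof -
  obtain F c where x: "x = (\<Sum>g\<in>F. c g * g)" and F: "finite F" "F \<subseteq> G" "\<forall>g\<in>F. c g \<in> R"
    using assms(1) by (auto simp: ideal_gen_def)
  have "r * x = (\<Sum>g\<in>F. (r * c g) * g)"
    by (simp add: x sum_distrib_left mult.assoc)
  then show ?thesis
    unfolding ideal_gen_def using F assms(2)
    by (auto intro!: exI[of _ F] exI[of _ "\<lambda>g. r * c g"] mult_mem)
qed

lemma ideal_gen_least:
  assumes "\<And>g. g \<in> G \<Longrightarrow> g \<in> ideal_gen R H"
  shows "ideal_gen R G \<subseteq> ideal_gen R H"
proof
  fix x assume "x \<in> ideal_gen R G"
  then show "x \<in> ideal_gen R H"
    by (induction rule: ideal_gen_induct)
      (auto intro: ideal_gen_zero ideal_gen_add ideal_gen_smult assms)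
qed

lemma ideal_gen_subset_ring:
  assumes "G \<subseteq> R" shows "ideal_gen R G \<subseteq> R"
proof
  fix x assume "x \<in> ideal_gen R G"
  then show "x \<in> R"
    by (induction rule: ideal_gen_induct) (use assms in \<open>auto intro: zero_mem add_mem mult_mem\<close>)
qed

lemma ideal_gen_mult:
  assumes "x \<in> ideal_gen R A" "y \<in> ideal_gen R B"
    and AB: "\<And>a b. a \<in> A \<Longrightarrow> b \<in> B \<Longrightarrow> a * b \<in> ideal_gen R D"
  shows "x * y \<in> ideal_gen R D"
  using assms(1)
proof (induction rule: ideal_gen_induct)
  case zero
  then show ?case by (simp add: ideal_gen_zero)
next
  case (add x x')
  then show ?case by (simp add: distrib_right ideal_gen_add)
next
  case (smult r a)
  have "a * y \<in> ideal_gen R D"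
    using assms(2)
  proof (induction rule: ideal_gen_induct)
    case zero
    then show ?case by (simp add: ideal_gen_zero)
  next
    case (add y y')
    then show ?case by (simp add: distrib_left ideal_gen_add)
  next
    case (smult s b)
    then show ?case
      using ideal_gen_smult[OF AB[OF \<open>a \<in> A\<close> smult(2)] smult(1)] by (simp add: mult.left_commute)
  qed
  from ideal_gen_smult[OF this smult(1)] show ?case by (simp add: mult.assoc)
qed

lemma ideal_pow_mult:
  assumes "x \<in> I" "y \<in> ideal_pow R I t"
  shows "x * y \<in> ideal_pow R I (Suc t)"
proof -
  have "a * b \<in> ideal_pow R I (Suc t)" if ab: "a \<in> {x}" "b \<in> {prod_list ps | ps. length ps = t \<and> set ps \<subseteq> I}" for a b
  proof -
    obtain ps where ps: "b = prod_list ps" "length ps = t" "set ps \<subseteq> I" using ab by auto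
    have "a * b = prod_list (x # ps)" "length (x # ps) = Suc t" "set (x # ps) \<subseteq> I"
      using ab ps assms by auto
    then show ?thesis
      unfolding ideal_pow_def by (intro ideal_gen_base) blast
  qed
  then show ?thesis
    using assms(2) ideal_gen_mult[OF ideal_gen_base[of x "{x}"]] unfolding ideal_pow_def by blast
qed

end

lemma polyring_coeff_ring: "coeff_ring (polyring m n)"
proof
  show "0 \<in> polyring m n" "1 \<in> polyring m n"
    by (auto simp: polyring_def)
next
  fix x y :: "'a mpoly" assume xy: "x \<in> polyring m n" "y \<in> polyring m n"
  then show "x + y \<in> polyring m n"
    using Poly_Mapping.keys_add[of x y] by (auto simp: polyring_def)
  show "x * y \<in> polyring m n"
    unfolding polyring_def
  proof clarify
    fix \<alpha> a b assume "\<alpha> \<in> Poly_Mapping.keys (x * y)" "(a, b) \<in> Poly_Mapping.keys \<alpha>"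
    then obtain \<beta> \<gamma> where "\<alpha> = \<beta> + \<gamma>" "\<beta> \<in> Poly_Mapping.keys x" "\<gamma> \<in> Poly_Mapping.keys y"
      using Poly_Mapping.keys_mult[of x y] by auto
    moreover have "(a, b) \<in> Poly_Mapping.keys \<beta> \<union> Poly_Mapping.keys \<gamma>"
      using \<open>(a, b) \<in> Poly_Mapping.keys \<alpha>\<close> calculation(1) Poly_Mapping.keys_add[of \<beta> \<gamma>] by auto
    ultimately show "a \<in> {1..m} \<and> b \<in> {1..n}"
      using xy unfolding polyring_def by blast
  qed
qed

section \<open>Leading monomials\<close>

lemma poly_mapping_sum_single:
  "p = (\<Sum>x\<in>Poly_Mapping.keys p. Poly_Mapping.single x (Poly_Mapping.lookup p x))"
  by (rule poly_mapping_eqI)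
    (auto simp: lookup_sum lookup_single when_def sum.delta in_keys_iff)

lemma mult_eq_sum_single:
  "p * q = (\<Sum>x\<in>Poly_Mapping.keys p. \<Sum>y\<in>Poly_Mapping.keys q.
      Poly_Mapping.single (x + y) (Poly_Mapping.lookup p x * Poly_Mapping.lookup q y))"
  by (subst poly_mapping_sum_single[of p], subst poly_mapping_sum_single[of q])
    (simp add: sum_product mult_single)

lemma lookup_mult_keys:
  "Poly_Mapping.lookup (p * q) k =
    (\<Sum>x\<in>Poly_Mapping.keys p. \<Sum>y\<in>Poly_Mapping.keys q.
      Poly_Mapping.lookup p x * Poly_Mapping.lookup q y when x + y = k)"
  by (simp add: mult_eq_sum_single[of p q] lookup_sum lookup_single)

text \<open>Only the pair (a, b) contributes to this coefficient, so nothing can cancel. Applied to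
  leading terms and to the marked term of a substituted monomial.\<close>

lemma lookup_mult_unique:
  assumes "\<And>x y. x \<in> Poly_Mapping.keys p \<Longrightarrow> y \<in> Poly_Mapping.keys q \<Longrightarrow> x + y = a + b \<Longrightarrow> x = a \<and> y = b"
  shows "Poly_Mapping.lookup (p * q) (a + b) = Poly_Mapping.lookup p a * Poly_Mapping.lookup q b"
proof -
  have "Poly_Mapping.lookup (p * q) (a + b) =
    (\<Sum>x\<in>Poly_Mapping.keys p. \<Sum>y\<in>Poly_Mapping.keys q.
      if x = a then if y = b then Poly_Mapping.lookup p x * Poly_Mapping.lookup q y else 0 else 0)"
    unfolding lookup_mult_keys by (intro sum.cong refl) (use assms in \<open>auto simp: when_def\<close>)
  also have "\<dots> = (\<Sum>x\<in>Poly_Mapping.keys p. if x = a then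
      (\<Sum>y\<in>Poly_Mapping.keys q. if y = b then Poly_Mapping.lookup p x * Poly_Mapping.lookup q y else 0) else 0)"
    by (intro sum.cong) auto
  also have "\<dots> = Poly_Mapping.lookup p a * Poly_Mapping.lookup q b"
    by (auto simp: sum.delta in_keys_iff)
  finally show ?thesis .
qed

text \<open>Both orders compare exponents at the first differing index, and smaller index pairs are
  larger variables. This makes a linear order compatible with addition available.\<close>

lemma lex_less_iff: "lex_less \<beta> \<alpha> \<longleftrightarrow> \<beta> < \<alpha>"
  by (simp add: lex_less_def less_poly_mapping.rep_eq less_fun_def var_gt_def less_prod_def')

lemma lead_mon_eqI:
  assumes "\<alpha> \<in> Poly_Mapping.keys p" "\<And>\<beta>. \<beta> \<in> Poly_Mapping.keys p \<Longrightarrow> \<beta> \<le> \<alpha>"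
  shows "lead_mon p = \<alpha>"
  unfolding lead_mon_def lex_less_iff
  by (rule the_equality) (use assms in \<open>auto simp: less_le intro: order.antisym\<close>)

lemma lead_mon_eq_Max:
  assumes "p \<noteq> 0" shows "lead_mon p = Max (Poly_Mapping.keys p)"
  by (rule lead_mon_eqI) (use assms in auto)

lemma lead_mon_in_keys: "p \<noteq> 0 \<Longrightarrow> lead_mon p \<in> Poly_Mapping.keys p"
  by (simp add: lead_mon_eq_Max)

lemma lead_mon_ge: "\<beta> \<in> Poly_Mapping.keys p \<Longrightarrow> \<beta> \<le> lead_mon p"
  by (subst lead_mon_eq_Max) auto

text \<open>The order is strictly compatible with addition, so the two leading monomials are the
  only pair with their sum, and a field has no zero divisors.\<close>

lemma lead_mon_mult:
  fixes p q :: "'k::field mpoly"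
  assumes "p \<noteq> 0" "q \<noteq> 0"
  shows "lead_mon (p * q) = lead_mon p + lead_mon q"
proof (rule lead_mon_eqI)
  have "x = lead_mon p \<and> y = lead_mon q"
    if "x \<in> Poly_Mapping.keys p" "y \<in> Poly_Mapping.keys q" "x + y = lead_mon p + lead_mon q" for x y
    using lead_mon_ge[OF that(1)] lead_mon_ge[OF that(2)] that(3)
    by (metis add_le_less_mono add_less_le_mono order_le_less order_less_irrefl)
  then show "lead_mon p + lead_mon q \<in> Poly_Mapping.keys (p * q)"
    using lookup_mult_unique[of p q "lead_mon p" "lead_mon q"] lead_mon_in_keys[OF assms(1)] lead_mon_in_keys[OF assms(2)]
    by (simp add: in_keys_iff)
next
  fix \<beta> assume "\<beta> \<in> Poly_Mapping.keys (p * q)"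
  then obtain x y where "\<beta> = x + y" "x \<in> Poly_Mapping.keys p" "y \<in> Poly_Mapping.keys q"
    using Poly_Mapping.keys_mult[of p q] by auto
  then show "\<beta> \<le> lead_mon p + lead_mon q"
    by (simp add: add_mono lead_mon_ge)
qed

section \<open>Products of initial ideals\<close>

lemma monom_poly_add: "monom_poly (a + b) = monom_poly a * monom_poly b"
  by (simp add: monom_poly_def mult_single)

lemma monom_poly_sum_list: "monom_poly (sum_list as) = prod_list (map monom_poly as)"
  by (induction as) (simp_all add: monom_poly_add, simp add: monom_poly_def)

text \<open>This yields the inclusion that holds for arbitrary \<open>I\<close>: a product of
  leading monomials is the leading monomial of the product.\<close>

lemma prod_init_ideal_mem:
  fixes I :: "'k::field mpoly set"
  assumes "coeff_ring R" "set ps \<subseteq> init_ideal R I"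
  shows "prod_list ps \<in> init_ideal R (ideal_pow R I (length ps))"
  using assms(2)
proof (induction ps)
  interpret coeff_ring R by fact
  case Nil
  have "lead_mon (1 :: 'k mpoly) = 0"
    by (rule lead_mon_eqI) auto
  then have "(1 :: 'k mpoly) = monom_poly (lead_mon (1 :: 'k mpoly))"
    by (simp add: monom_poly_def)
  moreover have "(1 :: 'k mpoly) \<in> ideal_pow R I 0"
    unfolding ideal_pow_def by (intro ideal_gen_base) auto
  ultimately show ?case
    unfolding init_ideal_def by (auto intro!: ideal_gen_base exI[of _ 1])
next
  interpret coeff_ring R by fact
  case (Cons p ps)
  have "p * prod_list ps \<in> init_ideal R (ideal_pow R I (Suc (length ps)))"
    unfolding init_ideal_def
  proof (rule ideal_gen_mult)
    show "p \<in> ideal_gen R {monom_poly (lead_mon f) |f. f \<in> I \<and> f \<noteq> 0}"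
      using Cons by (simp add: init_ideal_def)
    show "prod_list ps \<in> ideal_gen R {monom_poly (lead_mon f) |f. f \<in> ideal_pow R I (length ps) \<and> f \<noteq> 0}"
      using Cons by (simp add: init_ideal_def)
  next
    fix a b :: "'k mpoly"
    assume "a \<in> {monom_poly (lead_mon f) |f. f \<in> I \<and> f \<noteq> 0}"
      and "b \<in> {monom_poly (lead_mon f) |f. f \<in> ideal_pow R I (length ps) \<and> f \<noteq> 0}"
    then obtain f g where fg: "a = monom_poly (lead_mon f)" "b = monom_poly (lead_mon g)"
      "f \<in> I" "f \<noteq> 0" "g \<in> ideal_pow R I (length ps)" "g \<noteq> 0" by auto
    then have "a * b = monom_poly (lead_mon (f * g))" "f * g \<in> ideal_pow R I (Suc (length ps))" "f * g \<noteq> 0"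
      by (auto simp: lead_mon_mult monom_poly_add ideal_pow_mult)
    then show "a * b \<in> ideal_gen R {monom_poly (lead_mon f) |f. f \<in> ideal_pow R I (Suc (length ps)) \<and> f \<noteq> 0}"
      by (intro ideal_gen_base) blast
  qed
  then show ?case by simp
qed

lemma ideal_pow_init_subset:
  fixes I :: "'k::field mpoly set"
  assumes "coeff_ring R"
  shows "ideal_pow R (init_ideal R I) t \<subseteq> init_ideal R (ideal_pow R I t)"
proof -
  interpret coeff_ring R by fact
  show ?thesis
    unfolding ideal_pow_def[of R "init_ideal R I"] init_ideal_def[of R "ideal_pow R I t"]
    by (rule ideal_gen_least)
      (use prod_init_ideal_mem[OF assms] in \<open>auto simp: init_ideal_def\<close>)
qed

section \<open>Matchings and vertex covers in bipartite graphs\<close>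

definition vertex_cover :: "('v \<times> 'v) set \<Rightarrow> 'v set \<Rightarrow> bool" where
  "vertex_cover E C \<longleftrightarrow> (\<forall>(u, v)\<in>E. u \<in> C \<or> v \<in> C)"

text \<open>Splitting off an edge lowers the weight of a cover by the number of ends it contains, so
  no cover of weight \<open>Suc t\<close> may contain both ends. With \<open>u\<close> fixed, take a
  cover of that weight through \<open>u\<close> with largest trace on \<open>R\<close>, and choose
  \<open>v\<close> outside it.\<close>

lemma bipartite_edge_avoiding_min_covers:
  fixes w :: "'v \<Rightarrow> nat"
  assumes fin: "finite L" "finite R" and disj: "L \<inter> R = {}" and E: "E \<subseteq> L \<times> R"
    and cov: "\<And>C. C \<subseteq> L \<union> R \<Longrightarrow> vertex_cover E C \<Longrightarrow> Suc t \<le> sum w C"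
  obtains u v where "(u, v) \<in> E" "w u > 0" "w v > 0"
    "\<And>C. C \<subseteq> L \<union> R \<Longrightarrow> vertex_cover E C \<Longrightarrow> u \<in> C \<Longrightarrow> v \<in> C \<Longrightarrow> Suc (Suc t) \<le> sum w C"
proof -
  \<comment> \<open>\<open>W\<close> has weight 0, hence is not a cover, so some edge has two ends
    of positive weight.\<close>
  define W where "W = {x \<in> L \<union> R. w x = 0}"
  have W: "sum w W = 0" "W \<subseteq> L \<union> R" by (auto simp: W_def)
  with cov[of W] have "\<not> vertex_cover E W" by auto
  then obtain u v0 where uv0: "(u, v0) \<in> E" "w u > 0" "w v0 > 0"
    using E by (fastforce simp: vertex_cover_def W_def)
  have uL: "u \<in> L" using E uv0 by auto
  define M where "M = {C. C \<subseteq> L \<union> R \<and> vertex_cover E C \<and> sum w C = Suc t \<and> u \<in> C}"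
  have finM: "finite M"
    by (rule finite_subset[of _ "Pow (L \<union> R)"]) (use fin in \<open>auto simp: M_def\<close>)
  show ?thesis
  proof (cases "M = {}")
    case True
    show ?thesis
    proof (rule that[OF uv0])
      fix C assume C: "C \<subseteq> L \<union> R" "vertex_cover E C" "u \<in> C"
      then have "sum w C \<noteq> Suc t" using True by (auto simp: M_def)
      with cov[OF C(1,2)] show "Suc (Suc t) \<le> sum w C" by simp
    qed
  next
    case False
    define c where "c = Max ((\<lambda>C. card (C \<inter> R)) ` M)"
    have "c \<in> (\<lambda>C. card (C \<inter> R)) ` M"
      unfolding c_def using finM False by (intro Max_in) auto
    then obtain C where C: "C \<in> M" "card (C \<inter> R) = c" by auto
    have max: "card (D \<inter> R) \<le> card (C \<inter> R)" if "D \<in> M" for D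
      unfolding C(2) c_def using finM that by (intro Max_ge) auto
    have C': "C \<subseteq> L \<union> R" "vertex_cover E C" "sum w C = Suc t" "u \<in> C"
      using C by (auto simp: M_def)
    have finC: "finite C" using C'(1) fin by (meson finite_UnI finite_subset)
    have "\<exists>v. (u, v) \<in> E \<and> v \<notin> C \<and> w v > 0"
    proof (rule ccontr)
      assume neg: "\<not> ?thesis"
      \<comment> \<open>If every neighbour of \<open>u\<close> of positive weight were in
        \<open>C\<close>, then \<open>u\<close> could be traded for the weightless \<open>W\<close>,
        giving a cover lighter than \<open>Suc t\<close>.\<close>
      have "vertex_cover E ((C - {u}) \<union> W)"
        unfolding vertex_cover_def
      proof (intro ballI, unfold split_paired_all split_conv)
        fix x y assume xy: "(x, y) \<in> E"
        then have y: "y \<in> R" "y \<noteq> u" using E uL disj by auto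
        show "x \<in> (C - {u}) \<union> W \<or> y \<in> (C - {u}) \<union> W"
        proof (cases "x = u")
          case True
          then show ?thesis using neg xy y by (auto simp: W_def)
        next
          case False
          then show ?thesis using C'(2) xy y by (auto simp: vertex_cover_def)
        qed
      qed
      then have "Suc t \<le> sum w ((C - {u}) \<union> W)"
        using C'(1) W(2) by (intro cov) auto
      also have "\<dots> \<le> sum w (C - {u}) + sum w W"
        using fin W(2) finC by (intro sum_Un_nat[THEN eq_refl, THEN order_trans]) (auto intro: finite_subset)
      also have "\<dots> = Suc t - w u"
        using finC C' W(1) by (simp add: sum_diff1_nat)
      finally show False using uv0(2) by simp
    qed
    then obtain v where v: "(u, v) \<in> E" "v \<notin> C" "w v > 0" by blast
    have vR: "v \<in> R" using v E by auto
    show ?thesis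
    proof (rule that[OF v(1) uv0(2) v(3)], rule ccontr)
      fix D assume D: "D \<subseteq> L \<union> R" "vertex_cover E D" "u \<in> D" "v \<in> D"
        and "\<not> Suc (Suc t) \<le> sum w D"
      with cov[OF D(1,2)] have wD: "sum w D = Suc t" by simp
      have finD: "finite D" using D(1) fin by (meson finite_UnI finite_subset)
      \<comment> \<open>Vertex covers of a bipartite graph form a lattice on which the weight is modular.\<close>
      define X where "X = (C \<inter> D \<inter> L) \<union> ((C \<union> D) \<inter> R)"
      define Y where "Y = ((C \<union> D) \<inter> L) \<union> (C \<inter> D \<inter> R)"
      have XY: "X \<subseteq> L \<union> R" "Y \<subseteq> L \<union> R" by (auto simp: X_def Y_def)
      have covXY: "vertex_cover E X" "vertex_cover E Y"
        using C'(2) D(2) E by (fastforce simp: vertex_cover_def X_def Y_def)+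
      have "X \<union> Y = C \<union> D" "X \<inter> Y = C \<inter> D"
        using C'(1) D(1) disj by (auto simp: X_def Y_def)
      then have "sum w X + sum w Y = sum w C + sum w D"
        using finC finD sum.union_inter[of X Y w] sum.union_inter[of C D w]
        by (metis finite_Un)
      \<comment> \<open>Neither weight is below \<open>Suc t\<close> and they add up to twice that,
        so \<open>X\<close> belongs to \<open>M\<close> as well; but its trace on \<open>R\<close>
        contains \<open>v\<close> in addition to that of \<open>C\<close>.\<close>
      with cov[OF XY(1) covXY(1)] cov[OF XY(2) covXY(2)] C'(3) wD
      have "sum w X = Suc t" by simp
      then have "X \<in> M"
        using XY covXY C'(4) D(3) uL by (auto simp: M_def X_def)
      moreover have "insert v (C \<inter> R) \<subseteq> X \<inter> R"
        using vR D(4) by (auto simp: X_def)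
      then have "card (insert v (C \<inter> R)) \<le> card (X \<inter> R)"
        using fin by (intro card_mono) auto
      then have "card (C \<inter> R) < card (X \<inter> R)"
        using fin v(2) by simp
      ultimately show False using max[of X] by simp
    qed
  qed
qed

text \<open>Koenig's theorem with vertex weights \<open>\<mu>\<close>, proved by splitting off one
  edge at a time; \<open>es\<close> is a matching with multiplicities and \<open>\<rho>\<close> the
  unmatched weight.\<close>

lemma koenig_weighted:
  fixes \<mu> :: "'v \<Rightarrow>\<^sub>0 nat"
  assumes fin: "finite L" "finite R" and disj: "L \<inter> R = {}" and E: "E \<subseteq> L \<times> R"
    and cov: "\<And>C. C \<subseteq> L \<union> R \<Longrightarrow> vertex_cover E C \<Longrightarrow> t \<le> sum (Poly_Mapping.lookup \<mu>) C"
  shows "\<exists>es \<rho>. length es = t \<and> set es \<subseteq> E \<and>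
    \<mu> = \<rho> + (\<Sum>(u, v)\<leftarrow>es. Poly_Mapping.single u 1 + Poly_Mapping.single v 1)"
  using cov
proof (induction t arbitrary: \<mu>)
  case 0
  then show ?case by (intro exI[of _ "[]"]) auto
next
  case (Suc t)
  obtain u v where uv: "(u, v) \<in> E" "Poly_Mapping.lookup \<mu> u > 0" "Poly_Mapping.lookup \<mu> v > 0"
    and covuv: "\<And>C. C \<subseteq> L \<union> R \<Longrightarrow> vertex_cover E C \<Longrightarrow> u \<in> C \<Longrightarrow> v \<in> C \<Longrightarrow>
      Suc (Suc t) \<le> sum (Poly_Mapping.lookup \<mu>) C"
    using bipartite_edge_avoiding_min_covers[OF fin disj E Suc.prems] by blast
  define e where "e = Poly_Mapping.single u (1::nat) + Poly_Mapping.single v 1"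
  have neq: "u \<noteq> v" using uv(1) E disj by auto
  have \<mu>: "\<mu> = (\<mu> - e) + e"
    by (rule poly_mapping_eqI)
      (use uv neq in \<open>auto simp: e_def lookup_add lookup_minus lookup_single when_def\<close>)
  \<comment> \<open>A cover loses one unit for each end of the edge it contains; if it contains
    both, \<open>covuv\<close> supplies the extra unit.\<close>
  have "t \<le> sum (Poly_Mapping.lookup (\<mu> - e)) C" if C: "C \<subseteq> L \<union> R" "vertex_cover E C" for C
  proof -
    have "finite C" using C fin by (meson finite_UnI finite_subset)
    have "sum (Poly_Mapping.lookup \<mu>) C = sum (Poly_Mapping.lookup (\<mu> - e)) C + sum (Poly_Mapping.lookup e) C"
      by (subst \<mu>) (simp add: lookup_add sum.distrib)
    also have "sum (Poly_Mapping.lookup e) C = (if u \<in> C then 1 else 0) + (if v \<in> C then 1 else 0)"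
      using \<open>finite C\<close> by (simp add: e_def lookup_add lookup_single when_def sum.distrib sum.delta)
    finally show ?thesis
      using Suc.prems[OF C] covuv[OF C] by (auto split: if_splits)
  qed
  from Suc.IH[OF this] obtain es \<rho> where es: "length es = t" "set es \<subseteq> E"
    "\<mu> - e = \<rho> + (\<Sum>(u, v)\<leftarrow>es. Poly_Mapping.single u 1 + Poly_Mapping.single v 1)" by blast
  have "\<mu> = \<rho> + (\<Sum>(u, v)\<leftarrow>(u, v) # es. Poly_Mapping.single u 1 + Poly_Mapping.single v 1)"
    using \<mu> unfolding es(3) by (simp add: e_def ac_simps)
  then show ?case
    using es uv(1) by (intro exI[of _ "(u, v) # es"] exI[of _ \<rho>]) auto
qed

section \<open>Substitution homomorphisms\<close>

lemma monom_induct [case_names zero single add]: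
  fixes \<alpha> :: "'v \<Rightarrow>\<^sub>0 nat"
  assumes "P 0" and "\<And>v. P (Poly_Mapping.single v 1)" and "\<And>a b. P a \<Longrightarrow> P b \<Longrightarrow> P (a + b)"
  shows "P \<alpha>"
proof -
  have single: "P (Poly_Mapping.single v c)" for v c
  proof (induction c)
    case (Suc c)
    then show ?case using assms(3)[OF assms(2) Suc, of v] by (simp flip: single_add)
  qed (simp add: assms)
  have "P (\<Sum>v\<in>A. Poly_Mapping.single v (Poly_Mapping.lookup \<alpha> v))" for A
    by (induction A rule: infinite_finite_induct) (auto intro: assms single)
  then show ?thesis
    by (subst poly_mapping_sum_single)
qed

lemma keys_add_nat:
  fixes a b :: "'v \<Rightarrow>\<^sub>0 nat"
  shows "Poly_Mapping.keys (a + b) = Poly_Mapping.keys a \<union> Poly_Mapping.keys b"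
  by (auto simp: in_keys_iff lookup_add)

definition eval_monom :: "('v \<Rightarrow> 'r::comm_monoid_mult) \<Rightarrow> ('v \<Rightarrow>\<^sub>0 nat) \<Rightarrow> 'r" where
  "eval_monom h \<alpha> = (\<Prod>v\<in>Poly_Mapping.keys \<alpha>. h v ^ Poly_Mapping.lookup \<alpha> v)"

lemma eval_monom_superset:
  assumes "finite A" "Poly_Mapping.keys \<alpha> \<subseteq> A"
  shows "eval_monom h \<alpha> = (\<Prod>v\<in>A. h v ^ Poly_Mapping.lookup \<alpha> v)"
  unfolding eval_monom_def
  by (rule prod.mono_neutral_left) (use assms in \<open>auto simp: in_keys_iff\<close>)

lemma eval_monom_zero [simp]: "eval_monom h 0 = 1"
  by (simp add: eval_monom_def)

lemma eval_monom_single [simp]: "eval_monom h (Poly_Mapping.single v (Suc 0)) = h v"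
  by (simp add: eval_monom_def)

lemma eval_monom_add: "eval_monom h (a + b) = eval_monom h a * eval_monom h b"
proof -
  let ?A = "Poly_Mapping.keys a \<union> Poly_Mapping.keys b"
  show ?thesis
    by (subst (1 2 3) eval_monom_superset[of ?A])
      (auto simp: keys_add_nat lookup_add power_add prod.distrib)
qed

text \<open>The algebra homomorphism with \<open>x\<^sub>v\<close> sent to \<open>h v\<close>;
  \<open>single 0 c\<close> is the constant \<open>c\<close>. The target exponents form an arbitrary
  monoid, so that pairs of exponent vectors can be used.\<close>

definition subst_poly ::
  "('v \<Rightarrow> ('b::comm_monoid_add \<Rightarrow>\<^sub>0 'k::comm_ring_1)) \<Rightarrow> (('v \<Rightarrow>\<^sub>0 nat) \<Rightarrow>\<^sub>0 'k) \<Rightarrow> ('b \<Rightarrow>\<^sub>0 'k)" where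
  "subst_poly h p = (\<Sum>\<alpha>\<in>Poly_Mapping.keys p. Poly_Mapping.single 0 (Poly_Mapping.lookup p \<alpha>) * eval_monom h \<alpha>)"

lemma subst_poly_superset:
  assumes "finite A" "Poly_Mapping.keys p \<subseteq> A"
  shows "subst_poly h p = (\<Sum>\<alpha>\<in>A. Poly_Mapping.single 0 (Poly_Mapping.lookup p \<alpha>) * eval_monom h \<alpha>)"
  unfolding subst_poly_def
  by (rule sum.mono_neutral_left) (use assms in \<open>auto simp: in_keys_iff\<close>)

lemma subst_poly_zero [simp]: "subst_poly h 0 = 0"
  by (simp add: subst_poly_def)

lemma subst_poly_single: "subst_poly h (Poly_Mapping.single \<alpha> c) = Poly_Mapping.single 0 c * eval_monom h \<alpha>"
  by (subst subst_poly_superset[of "{\<alpha>}"]) auto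

lemma subst_poly_add: "subst_poly h (p + q) = subst_poly h p + subst_poly h q"
proof -
  let ?A = "Poly_Mapping.keys p \<union> Poly_Mapping.keys q"
  show ?thesis
    by (subst (1 2 3) subst_poly_superset[of ?A])
      (use Poly_Mapping.keys_add[of p q] in \<open>auto simp: lookup_add single_add distrib_right sum.distrib\<close>)
qed

lemma subst_poly_sum: "subst_poly h (sum f A) = (\<Sum>x\<in>A. subst_poly h (f x))"
  by (induction A rule: infinite_finite_induct) (simp_all add: subst_poly_add)

lemma subst_poly_mult:
  fixes h :: "'v \<Rightarrow> ('b::comm_monoid_add \<Rightarrow>\<^sub>0 'k::comm_ring_1)"
  shows "subst_poly h (p * q) = subst_poly h p * subst_poly h q"
proof -
  have "Poly_Mapping.single (0::'b) (c * d) = Poly_Mapping.single 0 c * Poly_Mapping.single 0 d" for c d :: 'k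
    by (simp add: mult_single)
  then have "subst_poly h (p * q) = (\<Sum>x\<in>Poly_Mapping.keys p. \<Sum>y\<in>Poly_Mapping.keys q.
      (Poly_Mapping.single 0 (Poly_Mapping.lookup p x) * eval_monom h x) *
      (Poly_Mapping.single 0 (Poly_Mapping.lookup q y) * eval_monom h y))"
    by (simp add: mult_eq_sum_single[of p q] subst_poly_sum subst_poly_single eval_monom_add ac_simps)
  then show ?thesis
    by (simp add: subst_poly_def sum_product)
qed

lemma subst_poly_diff: "subst_poly h (p - q) = subst_poly h p - subst_poly h q"
  using subst_poly_add[of h "p - q" q] by simp

lemma subst_poly_var: "subst_poly h (var i j) = h (i, j)"
  by (simp add: var_def subst_poly_single)

section \<open>Lifting vertex covers\<close>

text \<open>\<open>P\<close> plays the complement of a vertex cover: \<open>indep\<close> keeps the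
  two variables of a leading monomial \<open>x\<^sub>i\<^sub>,\<^sub>k
  x\<^sub>j\<^sub>,\<^sub>k\<^sub>+\<^sub>1\<close> with i < j from both lying in
  \<open>P\<close>.\<close>

locale independent_set =
  fixes m n :: nat and P :: "(nat \<times> nat) set"
  assumes P_subset: "P \<subseteq> {1..m} \<times> {1..n}"
    and indep: "(i, k) \<in> P \<Longrightarrow> (j, Suc k) \<in> P \<Longrightarrow> j \<le> i"
begin

section \<open>Runs of nonempty columns, margins and lexicographic minimality\<close>

definition cover :: "(nat \<times> nat) set" where
  "cover = {1..m} \<times> {1..n} - P"

definition empty_col :: "nat \<Rightarrow> bool" where
  "empty_col k \<longleftrightarrow> (\<forall>i. (i, k) \<notin> P)"

text \<open>This numbers the runs: it is constant on a run and grows past each empty column. An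
  empty column shares the number of a run ending just before it, which is harmless because
  \<open>rank_one\<close> vanishes there.\<close>

definition block :: "nat \<Rightarrow> nat" where
  "block k = card {z. z < k \<and> empty_col z}"

text \<open>The exponents of \<open>u\<^sub>i\<^sub>,\<^sub>b\<close> (left summand) and
  \<open>v\<^sub>k\<close> (right summand) after each \<open>x\<^sub>i\<^sub>,\<^sub>k\<close> is
  replaced by \<open>u\<^sub>i\<^sub>,\<^sub>b v\<^sub>k\<close> with
  \<open>b = block k\<close>.\<close>

definition margins :: "monom \<Rightarrow> (nat \<times> nat) + nat \<Rightarrow> nat" where
  "margins \<gamma> = case_sum
     (\<lambda>(i, b). \<Sum>k | k \<in> {1..n} \<and> block k = b. Poly_Mapping.lookup \<gamma> (i, k))
     (\<lambda>k. \<Sum>i\<in>{1..m}. Poly_Mapping.lookup \<gamma> (i, k))"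

lemma margins_zero: "margins 0 = 0"
  by (rule ext) (simp add: margins_def split: sum.split)

lemma margins_add: "margins (a + b) = margins a + margins b"
  by (rule ext) (auto simp: margins_def lookup_add sum.distrib split: sum.split)

lemma margins_single:
  assumes "i \<in> {1..m}" "k \<in> {1..n}"
  shows "margins (Poly_Mapping.single (i, k) c) (Inl (x, b)) = (if x = i \<and> block k = b then c else 0)"
    and "margins (Poly_Mapping.single (i, k) c) (Inr y) = (if y = k then c else 0)"
proof -
  have "(\<Sum>l | l \<in> {1..n} \<and> block l = b. Poly_Mapping.lookup (Poly_Mapping.single (i, k) c) (x, l))
    = (\<Sum>l | l \<in> {1..n} \<and> block l = b. if l = k then (if x = i then c else 0) else 0)"
    by (intro sum.cong) (auto simp: lookup_single when_def)
  also have "\<dots> = (if x = i \<and> block k = b then c else 0)"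
    using assms by (subst sum.delta) auto
  finally show "margins (Poly_Mapping.single (i, k) c) (Inl (x, b)) = (if x = i \<and> block k = b then c else 0)"
    by (simp add: margins_def)
  have "(\<Sum>l\<in>{1..m}. Poly_Mapping.lookup (Poly_Mapping.single (i, k) c) (l, y))
    = (\<Sum>l\<in>{1..m}. if l = i then (if y = k then c else 0) else 0)"
    by (intro sum.cong) (auto simp: lookup_single when_def)
  also have "\<dots> = (if y = k then c else 0)"
    using assms by (subst sum.delta) auto
  finally show "margins (Poly_Mapping.single (i, k) c) (Inr y) = (if y = k then c else 0)"
    by (simp add: margins_def)
qed

text \<open>The vanishing of the 2-minors of a rank one matrix, read on exponents; equal block
  numbers let both columns use the same \<open>u\<close>.\<close>

lemma margins_minor:
  assumes "block k = block l" "k \<in> {1..n}" "l \<in> {1..n}" "i \<in> {1..m}" "j \<in> {1..m}"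
  shows "margins (Poly_Mapping.single (i, k) c) + margins (Poly_Mapping.single (j, l) c)
    = margins (Poly_Mapping.single (i, l) c) + margins (Poly_Mapping.single (j, k) c)"
proof
  fix z
  show "(margins (Poly_Mapping.single (i, k) c) + margins (Poly_Mapping.single (j, l) c)) z
    = (margins (Poly_Mapping.single (i, l) c) + margins (Poly_Mapping.single (j, k) c)) z"
  proof (cases z)
    case (Inl p)
    obtain x b where "p = (x, b)" by (cases p)
    then show ?thesis
      by (simp only: Inl plus_fun_apply margins_single[OF assms(4,2)] margins_single[OF assms(4,3)]
          margins_single[OF assms(5,2)] margins_single[OF assms(5,3)] assms(1))
  next
    case (Inr y)
    then show ?thesis
      by (simp only: Inr plus_fun_apply margins_single[OF assms(4,2)] margins_single[OF assms(4,3)]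
          margins_single[OF assms(5,2)] margins_single[OF assms(5,3)] add.commute)
  qed
qed

lemma same_block_descending:
  assumes "(i, k) \<in> P" "(j, l) \<in> P" "k < l" "block k = block l"
  shows "j \<le> i"
proof -
  \<comment> \<open>An empty column from \<open>k\<close> up to but excluding \<open>l\<close> would
    raise the block number.\<close>
  have nonempty: "\<not> empty_col z" if "k \<le> z" "z < l" for z
  proof
    assume "empty_col z"
    then have "z \<in> {y. y < l \<and> empty_col y} - {y. y < k \<and> empty_col y}"
      using that by simp
    moreover have "{y. y < k \<and> empty_col y} \<subseteq> {y. y < l \<and> empty_col y}"
      using \<open>k < l\<close> by (intro Collect_mono) simp
    ultimately have "{y. y < k \<and> empty_col y} \<subset> {y. y < l \<and> empty_col y}"
      by blast
    then have "block k < block l"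
      unfolding block_def by (intro psubset_card_mono) simp_all
    with assms(4) show False by simp
  qed
  \<comment> \<open>Walk right column by column, applying \<open>indep\<close> to neighbouring
    columns. The walk starts in column \<open>Suc k\<close>, hence the offset
    \<open>l - Suc k\<close> at the end.\<close>
  have "j' \<le> i" if "(j', Suc (k + d)) \<in> P" "Suc (k + d) \<le> l" for d j'
    using that
  proof (induction d arbitrary: j')
    case 0
    then show ?case using indep[OF assms(1), of j'] by simp
  next
    case (Suc d)
    obtain q where q: "(q, Suc (k + d)) \<in> P"
      using nonempty[of "Suc (k + d)"] Suc.prems(2) by (auto simp: empty_col_def)
    have "q \<le> i" using Suc.IH[OF q] Suc.prems(2) by simp
    moreover have "j' \<le> q" using indep[OF q, of j'] Suc.prems(1) by simp
    ultimately show ?case by simp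
  qed
  from this[of j "l - Suc k"] show ?thesis using assms(2,3) by simp
qed

text \<open>At the first position (i, k) where \<open>\<gamma>\<close> falls below \<open>a\<close>, equality of the row sums forces an excess
  of \<open>\<gamma>\<close> at some (i, l) with l > k in the same block. As \<open>P\<close> has no point of column l below row i,
  this excess cannot be compensated in column l.\<close>

lemma lex_minimal:
  assumes "Poly_Mapping.keys a \<subseteq> P" and marg: "margins \<gamma> = margins a"
  shows "\<not> \<gamma> < a"
proof
  assume "\<gamma> < a"
  then obtain v where v: "Poly_Mapping.lookup \<gamma> v < Poly_Mapping.lookup a v"
    "\<forall>w<v. Poly_Mapping.lookup \<gamma> w = Poly_Mapping.lookup a w"
    unfolding less_poly_mapping.rep_eq less_fun_def by blast
  obtain i k where ik: "v = (i, k)" by (cases v)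
  have less: "Poly_Mapping.lookup \<gamma> (i, k) < Poly_Mapping.lookup a (i, k)"
    and eq: "\<And>w. w < (i, k) \<Longrightarrow> Poly_Mapping.lookup \<gamma> w = Poly_Mapping.lookup a w"
    using v unfolding ik by blast+
  have ikP: "(i, k) \<in> P" using less assms(1) in_keys_iff[of "(i, k)" a] by (intro subsetD[OF assms(1)]) simp
  let ?K = "{l. l \<in> {1..n} \<and> block l = block k}"
  have kK: "k \<in> ?K" using ikP P_subset by auto
  have finK: "finite ?K" by simp
  have "(\<Sum>l\<in>?K. Poly_Mapping.lookup \<gamma> (i, l)) = (\<Sum>l\<in>?K. Poly_Mapping.lookup a (i, l))"
    using fun_cong[OF marg, of "Inl (i, block k)"] by (simp add: margins_def)
  then have sums: "\<not> (\<Sum>l\<in>?K. Poly_Mapping.lookup \<gamma> (i, l)) < (\<Sum>l\<in>?K. Poly_Mapping.lookup a (i, l))"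
    by simp
  have "(\<Sum>l\<in>?K. Poly_Mapping.lookup \<gamma> (i, l)) < (\<Sum>l\<in>?K. Poly_Mapping.lookup a (i, l))"
    if "\<forall>l\<in>?K. Poly_Mapping.lookup \<gamma> (i, l) \<le> Poly_Mapping.lookup a (i, l)"
    using that kK less by (intro sum_strict_mono_ex1[OF finK]) blast+
  with sums obtain l where l: "l \<in> ?K" "Poly_Mapping.lookup a (i, l) < Poly_Mapping.lookup \<gamma> (i, l)"
    by (meson not_le)
  have "\<not> l < k" using l(2) eq[of "(i, l)"] by auto
  moreover have "l \<noteq> k" using l(2) less by auto
  ultimately have kl: "k < l" by simp
  have "i \<in> {1..m}" using ikP P_subset by auto
  have "Poly_Mapping.lookup a (j, l) \<le> Poly_Mapping.lookup \<gamma> (j, l)" for j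
  proof -
    consider "j < i" | "j = i" | "j > i" by linarith
    then show ?thesis
    proof cases
      case 1 then show ?thesis using eq[of "(j, l)"] by simp
    next
      case 2 then show ?thesis using l by simp
    next
      case 3
      then have "(j, l) \<notin> P" using same_block_descending[OF ikP _ kl, of j] l(1) by auto
      then have "Poly_Mapping.lookup a (j, l) = 0" using assms(1) in_keys_iff[of "(j, l)" a] by blast
      then show ?thesis by simp
    qed
  qed
  then have "(\<Sum>j\<in>{1..m}. Poly_Mapping.lookup a (j, l)) < (\<Sum>j\<in>{1..m}. Poly_Mapping.lookup \<gamma> (j, l))"
    using \<open>i \<in> {1..m}\<close> l(2) by (intro sum_strict_mono_ex1) blast+
  then show False
    using fun_cong[OF marg, of "Inr l"] by (simp add: margins_def)
qed

text \<open>The first component of an exponent records the variables \<open>y\<^sub>v\<close>, the second the exponents of the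
  parameters \<open>u\<^sub>i\<^sub>,\<^sub>b\<close> and \<open>v\<^sub>k\<close> of a rank one matrix \<open>u\<^sub>i\<^sub>,\<^sub>b v\<^sub>k\<close> on each block \<open>b\<close> of columns.\<close>

definition rank_one :: "nat \<times> nat \<Rightarrow> (monom \<times> ((nat \<times> nat) + nat \<Rightarrow> nat)) \<Rightarrow>\<^sub>0 'k::field" where
  "rank_one v = (if empty_col (snd v) then 0
     else Poly_Mapping.single (0, margins (Poly_Mapping.single v 1)) 1)"

definition tangent :: "nat \<times> nat \<Rightarrow> (monom \<times> ((nat \<times> nat) + nat \<Rightarrow> nat)) \<Rightarrow>\<^sub>0 'k::field" where
  "tangent v = (if v \<in> cover then Poly_Mapping.single (Poly_Mapping.single v 1, 0) 1 else 0)"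

definition lift_var :: "nat \<times> nat \<Rightarrow> (monom \<times> ((nat \<times> nat) + nat \<Rightarrow> nat)) \<Rightarrow>\<^sub>0 'k::field" where
  "lift_var v = rank_one v + tangent v"

text \<open>The d-th power of the ideal generated by the \<open>y\<^sub>v\<close> with
  \<open>v\<close> in \<open>cover\<close>; being a monomial ideal, it is described by its
  terms.\<close>

definition filt :: "nat \<Rightarrow> ((monom \<times> ((nat \<times> nat) + nat \<Rightarrow> nat)) \<Rightarrow>\<^sub>0 'k::field) set" where
  "filt d = {p. \<forall>k\<in>Poly_Mapping.keys p. d \<le> sum (Poly_Mapping.lookup (fst k)) cover}"

section \<open>Images of the ideal and its powers in the filtration\<close>

lemma finite_cover: "finite cover"
  by (simp add: cover_def)

lemma filt_zero: "0 \<in> filt d"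
  by (simp add: filt_def)

lemma filt_0: "p \<in> filt 0"
  by (simp add: filt_def)

lemma filt_add: "p \<in> filt d \<Longrightarrow> q \<in> filt d \<Longrightarrow> p + q \<in> filt d"
  using Poly_Mapping.keys_add[of p q] unfolding filt_def by blast

lemma filt_diff: "p \<in> filt d \<Longrightarrow> q \<in> filt d \<Longrightarrow> p - q \<in> filt d"
  using keys_diff[of p q] unfolding filt_def by blast

lemma filt_mult:
  assumes "p \<in> filt a" "q \<in> filt b"
  shows "p * q \<in> filt (a + b)"
  unfolding filt_def
proof (intro CollectI ballI)
  fix k assume "k \<in> Poly_Mapping.keys (p * q)"
  then obtain x y where k: "k = x + y" and xy: "x \<in> Poly_Mapping.keys p" "y \<in> Poly_Mapping.keys q"
    using Poly_Mapping.keys_mult[of p q] by blast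
  have "a \<le> sum (Poly_Mapping.lookup (fst x)) cover" "b \<le> sum (Poly_Mapping.lookup (fst y)) cover"
    using assms xy unfolding filt_def by blast+
  then show "a + b \<le> sum (Poly_Mapping.lookup (fst k)) cover"
    by (simp add: k lookup_add sum.distrib)
qed

lemma filt_mult_left: "p \<in> filt d \<Longrightarrow> q * p \<in> filt d"
  using filt_mult[OF filt_0[of q], of p d] by simp

lemma tangent_filt: "tangent v \<in> filt 1"
proof (cases "v \<in> cover")
  case True
  have "sum (Poly_Mapping.lookup (Poly_Mapping.single v (1::nat))) cover = (\<Sum>x\<in>cover. if x = v then 1 else 0)"
    by (intro sum.cong) (simp_all add: lookup_single when_def)
  also have "\<dots> = 1" using True finite_cover by (simp add: sum.delta)
  finally show ?thesis using True by (simp add: filt_def tangent_def)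
qed (simp add: tangent_def filt_zero)

text \<open>An empty column kills a factor on each side. Two adjacent nonempty columns lie in one
  run, where the matrix has rank one.\<close>

lemma rank_one_minor:
  assumes "i \<in> {1..m}" "j \<in> {1..m}" "k \<in> {1..n}" "Suc k \<in> {1..n}"
  shows "rank_one (i, k) * rank_one (j, Suc k) = rank_one (i, Suc k) * rank_one (j, k)"
proof (cases "empty_col k \<or> empty_col (Suc k)")
  case True
  then show ?thesis by (auto simp: rank_one_def)
next
  case False
  then have "{z. z < Suc k \<and> empty_col z} = {z. z < k \<and> empty_col z}"
    using less_Suc_eq by blast
  then have "block k = block (Suc k)" by (simp add: block_def)
  from margins_minor[OF this assms(3,4,1,2), of 1] show ?thesis
    using False by (simp add: rank_one_def mult_single)
qed

text \<open>The pure rank one part of the image cancels; every remaining product has a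
  \<open>tangent\<close> factor.\<close>

lemma subst_minor_filt:
  assumes "i \<in> {1..m}" "j \<in> {1..m}" "k \<in> {1..n}" "Suc k \<in> {1..n}"
  shows "subst_poly lift_var (minor2 i j k (Suc k)) \<in> filt 1"
proof -
  have "subst_poly lift_var (minor2 i j k (Suc k)) =
      lift_var (j, Suc k) * tangent (i, k) + rank_one (i, k) * tangent (j, Suc k)
      - (lift_var (j, k) * tangent (i, Suc k) + rank_one (i, Suc k) * tangent (j, k))"
    using rank_one_minor[OF assms]
    by (simp add: minor2_def subst_poly_diff subst_poly_mult subst_poly_var lift_var_def algebra_simps)
  also have "\<dots> \<in> filt 1"
    by (intro filt_diff filt_add filt_mult_left tangent_filt)
  finally show ?thesis .
qed

lemma subst_J_filt:
  assumes "f \<in> J_KmPn m n"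
  shows "subst_poly lift_var f \<in> filt 1"
  using assms unfolding J_KmPn_def
proof (induction rule: ideal_gen_induct)
  case zero
  then show ?case by (simp add: filt_zero)
next
  case (add x y)
  then show ?case by (simp add: subst_poly_add filt_add)
next
  case (smult r g)
  then obtain i j k where g: "g = minor2 i j k (Suc k)"
    and ijk: "1 \<le> i" "i < j" "j \<le> m" "1 \<le> k" "k \<le> n - 1" by auto
  have "subst_poly lift_var g \<in> filt 1"
    unfolding g by (rule subst_minor_filt) (use ijk in simp_all)
  then show ?case by (simp add: subst_poly_mult filt_mult_left)
qed

lemma subst_J_pow_filt:
  assumes "f \<in> ideal_pow R (J_KmPn m n) t"
  shows "subst_poly lift_var f \<in> filt t"
  using assms unfolding ideal_pow_def
proof (induction rule: ideal_gen_induct)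
  case zero
  then show ?case by (simp add: filt_zero)
next
  case (add x y)
  then show ?case by (simp add: subst_poly_add filt_add)
next
  case (smult r g)
  then obtain ps where g: "g = prod_list ps" "length ps = t" "set ps \<subseteq> J_KmPn m n" by blast
  have "subst_poly lift_var (prod_list ps) \<in> filt (length ps)"
    using g(3)
  proof (induction ps)
    case Nil
    then show ?case by (simp add: filt_0)
  next
    case (Cons p ps)
    then have "subst_poly lift_var p * subst_poly lift_var (prod_list ps) \<in> filt (1 + length ps)"
      by (intro filt_mult subst_J_filt) simp_all
    then show ?case by (simp add: subst_poly_mult)
  qed
  then show ?case using g by (simp add: subst_poly_mult filt_mult_left)
qed

text \<open>Expanding the product sends each variable of \<open>\<beta>\<close> to its
  \<open>y\<close> or to its product of parameters. The latter variables make up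
  \<open>\<gamma>\<close>, so a term determines \<open>\<beta>\<close> up to a monomial with known
  margins.\<close>

lemma keys_eval_lift_var:
  assumes "(b, x) \<in> Poly_Mapping.keys (eval_monom (lift_var :: _ \<Rightarrow> _ \<Rightarrow>\<^sub>0 'k::field) \<beta>)"
  shows "\<exists>\<gamma>. b + \<gamma> = \<beta> \<and> x = margins \<gamma>"
  using assms
proof (induction \<beta> arbitrary: b x rule: monom_induct)
  case zero
  then have "(b, x) = 0" by simp
  then have "b + 0 = 0" "x = margins 0" unfolding margins_zero zero_prod_def by simp_all
  then show ?case by blast
next
  case (single v)
  then have "(b, x) \<in> Poly_Mapping.keys (rank_one v :: _ \<Rightarrow>\<^sub>0 'k) \<union> Poly_Mapping.keys (tangent v :: _ \<Rightarrow>\<^sub>0 'k)"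
    using Poly_Mapping.keys_add[of "rank_one v :: _ \<Rightarrow>\<^sub>0 'k" "tangent v"] by (auto simp: lift_var_def)
  then have "b = 0 \<and> x = margins (Poly_Mapping.single v 1) \<or> b = Poly_Mapping.single v 1 \<and> x = margins 0"
    unfolding margins_zero by (auto simp: rank_one_def tangent_def split: if_splits)
  then show ?case by (metis add.left_neutral add.right_neutral)
next
  case (add \<beta>1 \<beta>2)
  let ?h = "lift_var :: _ \<Rightarrow> _ \<Rightarrow>\<^sub>0 'k"
  obtain k1 k2 where k: "(b, x) = k1 + k2" "k1 \<in> Poly_Mapping.keys (eval_monom ?h \<beta>1)"
    "k2 \<in> Poly_Mapping.keys (eval_monom ?h \<beta>2)"
    using add.prems Poly_Mapping.keys_mult[of "eval_monom ?h \<beta>1" "eval_monom ?h \<beta>2"] unfolding eval_monom_add by blast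
  obtain b1 x1 b2 x2 where k12: "k1 = (b1, x1)" "k2 = (b2, x2)" by (cases k1, cases k2)
  obtain \<gamma>1 \<gamma>2 where \<gamma>: "b1 + \<gamma>1 = \<beta>1" "x1 = margins \<gamma>1" "b2 + \<gamma>2 = \<beta>2" "x2 = margins \<gamma>2"
    using add.IH(1)[of b1 x1] add.IH(2)[of b2 x2] k unfolding k12 by blast
  have "b + (\<gamma>1 + \<gamma>2) = \<beta>1 + \<beta>2" "x = margins (\<gamma>1 + \<gamma>2)"
    using k(1) \<gamma> by (simp_all add: k12 margins_add flip: \<gamma>(1,3) add: ac_simps)
  then show ?case by blast
qed

text \<open>On \<open>P\<close> the \<open>tangent\<close> summand is absent and no column is empty,
  so each variable goes to a single term.\<close>

lemma eval_lift_var_P: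
  assumes "Poly_Mapping.keys a \<subseteq> P"
  shows "eval_monom lift_var a = Poly_Mapping.single (0, margins a) 1"
  using assms
proof (induction a rule: monom_induct)
  case zero
  show ?case unfolding eval_monom_zero margins_zero zero_prod_def[symmetric] single_one ..
next
  case (single v)
  then have "v \<in> P" by simp
  then have "\<not> empty_col (snd v)" "v \<notin> cover"
    by (auto simp: empty_col_def cover_def intro: exI[of _ "fst v"])
  then show ?case by (simp add: lift_var_def rank_one_def tangent_def)
next
  case (add a b)
  then show ?case by (simp add: keys_add_nat eval_monom_add mult_single margins_add plus_fun_def)
qed

text \<open>The pure \<open>y\<close> term arises only by choosing \<open>y\<close> in every factor,
  so no other choice can cancel it.\<close>

lemma lookup_eval_lift_var_cover:
  assumes "Poly_Mapping.keys b \<subseteq> cover"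
  shows "Poly_Mapping.lookup (eval_monom (lift_var :: _ \<Rightarrow> _ \<Rightarrow>\<^sub>0 'k::field) b) (b, 0) = 1"
  using assms
proof (induction b rule: monom_induct)
  case zero
  show ?case unfolding eval_monom_zero zero_prod_def[symmetric] by (rule lookup_one_zero)
next
  case (single v)
  have "(0 :: monom) \<noteq> Poly_Mapping.single v (Suc 0)"
    by (metis lookup_single_eq lookup_zero nat.distinct(1))
  then show ?case using single
    by (simp add: lift_var_def rank_one_def tangent_def lookup_add lookup_single zero_fun_def)
next
  case (add b1 b2)
  let ?h = "lift_var :: _ \<Rightarrow> _ \<Rightarrow>\<^sub>0 'k"
  have "Poly_Mapping.lookup (eval_monom ?h b1 * eval_monom ?h b2) ((b1, 0) + (b2, 0))
    = Poly_Mapping.lookup (eval_monom ?h b1) (b1, 0) * Poly_Mapping.lookup (eval_monom ?h b2) (b2, 0)"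
  proof (rule lookup_mult_unique)
    fix k l
    assume kl: "k \<in> Poly_Mapping.keys (eval_monom ?h b1)" "l \<in> Poly_Mapping.keys (eval_monom ?h b2)"
      "k + l = (b1, 0) + (b2, 0)"
    obtain c1 x1 c2 x2 where c: "k = (c1, x1)" "l = (c2, x2)" by (cases k, cases l)
    obtain \<gamma>1 \<gamma>2 where \<gamma>: "c1 + \<gamma>1 = b1" "x1 = margins \<gamma>1" "c2 + \<gamma>2 = b2" "x2 = margins \<gamma>2"
      using keys_eval_lift_var kl(1,2) unfolding c by metis
    \<comment> \<open>Each \<open>y\<close> exponent falls short of the full monomial by its
      \<open>\<gamma>\<close>, but the totals agree; hence both shortfalls vanish.\<close>
    have "c1 + c2 = (c1 + \<gamma>1) + (c2 + \<gamma>2)" using kl(3) \<gamma> by (simp add: c)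
    then have "\<gamma>1 + \<gamma>2 = 0"
      by (metis (no_types, lifting) add.assoc add.commute add_cancel_left_right)
    then have "Poly_Mapping.lookup \<gamma>1 v + Poly_Mapping.lookup \<gamma>2 v = 0" for v
      by (metis lookup_add lookup_zero)
    then have "\<gamma>1 = 0" "\<gamma>2 = 0" by (auto intro: poly_mapping_eqI)
    then show "k = (b1, 0) \<and> l = (b2, 0)" using \<gamma> by (simp add: c margins_zero zero_fun_def)
  qed
  then show ?case using add by (simp add: keys_add_nat eval_monom_add zero_fun_def plus_fun_def)
qed

lemma lead_mon_cover_degree:
  fixes f :: "'k::field mpoly"
  assumes f: "f \<in> ideal_pow R (J_KmPn m n) t" "f \<noteq> 0" "f \<in> polyring m n"
  shows "t \<le> sum (Poly_Mapping.lookup (lead_mon f)) cover"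
proof -
  define \<alpha> where "\<alpha> = lead_mon f"
  have \<alpha>: "\<alpha> \<in> Poly_Mapping.keys f" unfolding \<alpha>_def by (rule lead_mon_in_keys) fact
  then have keys\<alpha>: "Poly_Mapping.keys \<alpha> \<subseteq> P \<union> cover" using f(3) by (auto simp: polyring_def cover_def)
  define restr where "restr A = (\<Sum>v\<in>Poly_Mapping.keys \<alpha> \<inter> A. Poly_Mapping.single v (Poly_Mapping.lookup \<alpha> v))" for A
  have restr: "Poly_Mapping.lookup (restr A) v = (if v \<in> A then Poly_Mapping.lookup \<alpha> v else 0)" for A v
  proof -
    have "Poly_Mapping.lookup (restr A) v = (\<Sum>x\<in>Poly_Mapping.keys \<alpha> \<inter> A. if x = v then Poly_Mapping.lookup \<alpha> x else 0)"
      unfolding restr_def lookup_sum by (intro sum.cong) (simp_all add: lookup_single when_def)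
    also have "\<dots> = (if v \<in> A then Poly_Mapping.lookup \<alpha> v else 0)"
      by (simp add: sum.delta in_keys_iff)
    finally show ?thesis .
  qed
  define a b where "a = restr P" and "b = restr cover"
  have ab: "\<alpha> = a + b"
  proof (rule poly_mapping_eqI)
    fix v
    have "v \<in> P \<or> v \<in> cover \<or> Poly_Mapping.lookup \<alpha> v = 0"
      using keys\<alpha> in_keys_iff[of v \<alpha>] by blast
    moreover have "\<not> (v \<in> P \<and> v \<in> cover)" by (simp add: cover_def)
    ultimately show "Poly_Mapping.lookup \<alpha> v = Poly_Mapping.lookup (a + b) v"
      by (simp add: a_def b_def lookup_add restr) blast
  qed
  have aP: "Poly_Mapping.keys a \<subseteq> P" and bC: "Poly_Mapping.keys b \<subseteq> cover"
    by (auto simp: a_def b_def in_keys_iff restr split: if_splits)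
  let ?\<kappa> = "(b, margins a)"
  let ?h = "lift_var :: nat \<times> nat \<Rightarrow> _ \<Rightarrow>\<^sub>0 'k"
  have lookup_const: "Poly_Mapping.lookup (Poly_Mapping.single 0 c * q) k = c * Poly_Mapping.lookup q k"
    for c :: 'k and q and k :: "monom \<times> ((nat \<times> nat) + nat \<Rightarrow> nat)"
    using lookup_mult_unique[of "Poly_Mapping.single 0 c" q 0 k] by (cases "c = 0") simp_all
  \<comment> \<open>The image of \<open>a\<close> is one term, so the marked term of the product
    arises in one way only.\<close>
  have "Poly_Mapping.lookup (eval_monom ?h a * eval_monom ?h b) ((0, margins a) + (b, 0))
      = Poly_Mapping.lookup (eval_monom ?h a) (0, margins a) * Poly_Mapping.lookup (eval_monom ?h b) (b, 0)"
  proof (rule lookup_mult_unique)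
    fix x y assume "x \<in> Poly_Mapping.keys (eval_monom ?h a)" and xy: "x + y = (0, margins a) + (b, 0)"
    then have x: "x = (0, margins a)" unfolding eval_lift_var_P[OF aP] by simp
    show "x = (0, margins a) \<and> y = (b, 0)" using xy unfolding x add_left_cancel by blast
  qed
  then have lead: "Poly_Mapping.lookup (eval_monom ?h \<alpha>) ?\<kappa> = 1"
    unfolding ab eval_monom_add lookup_eval_lift_var_cover[OF bC] by (simp add: eval_lift_var_P[OF aP])
  have other: "Poly_Mapping.lookup (eval_monom ?h \<beta>) ?\<kappa> = 0"
    if "\<beta> \<in> Poly_Mapping.keys f" "\<beta> \<noteq> \<alpha>" for \<beta>
  proof (rule ccontr)
    assume "\<not> ?thesis"
    then obtain \<gamma> where \<gamma>: "b + \<gamma> = \<beta>" "margins a = margins \<gamma>"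
      using keys_eval_lift_var[of b "margins a" \<beta>] by (metis in_keys_iff)
    \<comment> \<open>Cancelling \<open>b\<close> turns this into \<open>\<gamma> < a\<close>,
      against the minimality of \<open>a\<close> among monomials with its margins.\<close>
    have "\<beta> < \<alpha>" using lead_mon_ge[OF that(1)] that(2) by (simp add: \<alpha>_def)
    then have "b + \<gamma> < b + a" unfolding \<gamma>(1) ab by (simp only: add.commute)
    then have "\<gamma> < a" by (rule add_less_imp_less_left)
    then show False using lex_minimal[OF aP \<gamma>(2)[symmetric]] by simp
  qed
  have "Poly_Mapping.lookup (subst_poly ?h f) ?\<kappa> =
      (\<Sum>\<beta>\<in>Poly_Mapping.keys f. if \<beta> = \<alpha> then Poly_Mapping.lookup f \<alpha> else 0)"
    unfolding subst_poly_def lookup_sum lookup_const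
    by (intro sum.cong) (simp_all add: lead other)
  also have "\<dots> = Poly_Mapping.lookup f \<alpha>" using \<alpha> by (simp add: sum.delta)
  finally have "?\<kappa> \<in> Poly_Mapping.keys (subst_poly ?h f)" using \<alpha> by (simp add: in_keys_iff)
  then have "t \<le> sum (Poly_Mapping.lookup b) cover"
    using subst_J_pow_filt[OF f(1)] unfolding filt_def by fastforce
  also have "\<dots> = sum (Poly_Mapping.lookup \<alpha>) cover"
    by (intro sum.cong) (simp_all add: b_def restr)
  finally show ?thesis unfolding \<alpha>_def .
qed

end

section \<open>Powers of the initial ideal\<close>

lemma lead_mon_minor2:
  assumes "i < j" "k < l"
  shows "lead_mon (minor2 i j k l :: 'k::field mpoly) = Poly_Mapping.single (i, k) 1 + Poly_Mapping.single (j, l) 1"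
    and "(minor2 i j k l :: 'k::field mpoly) \<noteq> 0"
proof -
  let ?p = "minor2 i j k l :: 'k mpoly"
  let ?\<alpha> = "Poly_Mapping.single (i, k) (1::nat) + Poly_Mapping.single (j, l) 1"
  let ?\<beta> = "Poly_Mapping.single (i, l) (1::nat) + Poly_Mapping.single (j, k) 1"
  have p: "?p = Poly_Mapping.single ?\<alpha> 1 - Poly_Mapping.single ?\<beta> 1"
    by (simp add: minor2_def var_def mult_single)
  \<comment> \<open>Of the four variables involved, the one at \<open>(i, k)\<close> is the largest,
    and it occurs only in \<open>?\<alpha>\<close>.\<close>
  have less: "?\<beta> < ?\<alpha>"
    unfolding less_poly_mapping.rep_eq less_fun_def
    by (rule exI[of _ "(i, k)"]) (use assms in \<open>auto simp: lookup_add lookup_single when_def\<close>)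
  then have neq: "?\<beta> \<noteq> ?\<alpha>" by (rule less_imp_neq)
  have "Poly_Mapping.lookup ?p ?\<alpha> = 1"
    unfolding p lookup_minus by (simp only: lookup_single_eq lookup_single_not_eq[OF neq] diff_zero)
  then have \<alpha>: "?\<alpha> \<in> Poly_Mapping.keys ?p" unfolding in_keys_iff by simp
  then show "?p \<noteq> 0" by force
  show "lead_mon ?p = ?\<alpha>"
  proof (rule lead_mon_eqI[OF \<alpha>])
    fix \<delta> assume "\<delta> \<in> Poly_Mapping.keys ?p"
    then have "\<delta> = ?\<alpha> \<or> \<delta> = ?\<beta>"
      using keys_diff[of "Poly_Mapping.single ?\<alpha> (1::'k)" "Poly_Mapping.single ?\<beta> 1"] unfolding p by auto
    then show "\<delta> \<le> ?\<alpha>" using less by auto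
  qed
qed

lemma J_pow_subset_polyring:
  "ideal_pow (polyring m n) (J_KmPn m n) t \<subseteq> (polyring m n :: 'k::field mpoly set)"
proof -
  interpret coeff_ring "polyring m n :: 'k mpoly set" by (rule polyring_coeff_ring)
  have minus: "x - y \<in> polyring m n" if "x \<in> polyring m n" "y \<in> polyring m n" for x y :: "'k mpoly"
    using that keys_diff[of x y] unfolding polyring_def by blast
  have var: "(var i j :: 'k mpoly) \<in> polyring m n" if "i \<in> {1..m}" "j \<in> {1..n}" for i j
    using that by (simp add: polyring_def var_def)
  have "(minor2 i j k (k + 1) :: 'k mpoly) \<in> polyring m n" if "1 \<le> i" "i < j" "j \<le> m" "1 \<le> k" "k \<le> n - 1" for i j k
    unfolding minor2_def by (rule minus; intro mult_mem var) (use that in simp_all)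
  then have J: "J_KmPn m n \<subseteq> (polyring m n :: 'k mpoly set)"
    unfolding J_KmPn_def by (intro ideal_gen_subset_ring) blast
  have "prod_list ps \<in> polyring m n" if "set ps \<subseteq> J_KmPn m n" for ps :: "'k mpoly list"
    using that by (induction ps) (use J in \<open>auto intro: one_mem mult_mem\<close>)
  then show ?thesis
    unfolding ideal_pow_def by (intro ideal_gen_subset_ring) blast
qed

text \<open>The inclusion special to this ideal: weighted Koenig turns the degree bounds over all
  covers into a factor of the leading monomial made of \<open>t\<close> leading monomials of
  generators.\<close>

lemma lead_mon_J_pow_mem:
  fixes f :: "'k::field mpoly"
  assumes f: "f \<in> ideal_pow (polyring m n) (J_KmPn m n) t" "f \<noteq> 0"
  shows "monom_poly (lead_mon f) \<in>
    ideal_pow (polyring m n) (init_ideal (polyring m n) (J_KmPn m n :: 'k mpoly set)) t"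
proof -
  interpret coeff_ring "polyring m n :: 'k mpoly set" by (rule polyring_coeff_ring)
  let ?V = "{1..m} \<times> {1..n}"
  let ?I = "init_ideal (polyring m n) (J_KmPn m n :: 'k mpoly set)"
  define edge where "edge u v \<longleftrightarrow> fst u < fst v \<and> snd v = Suc (snd u)" for u v :: "nat \<times> nat"
  define L where "L = {v \<in> ?V. even (snd v)}"
  define R where "R = {v \<in> ?V. odd (snd v)}"
  \<comment> \<open>Adjacent columns have opposite parity. An edge is stored with its even column
    first, so it may point left or right.\<close>
  define E where "E = {(u, v). u \<in> L \<and> v \<in> R \<and> (edge u v \<or> edge v u)}"
  have V: "L \<union> R = ?V" by (auto simp: L_def R_def)
  have fp: "f \<in> polyring m n" using f(1) J_pow_subset_polyring by blast
  have "\<exists>es \<rho>. length es = t \<and> set es \<subseteq> E \<and>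
    lead_mon f = \<rho> + (\<Sum>(u, v)\<leftarrow>es. Poly_Mapping.single u 1 + Poly_Mapping.single v 1)"
  proof (rule koenig_weighted)
    show "finite L" "finite R" by (auto simp: L_def R_def)
    show "L \<inter> R = {}" "E \<subseteq> L \<times> R" by (auto simp: L_def R_def E_def)
    fix C assume C: "C \<subseteq> L \<union> R" "vertex_cover E C"
    interpret I: independent_set m n "?V - C"
    proof
      show "?V - C \<subseteq> ?V" by blast
      fix i k j assume ij: "(i, k) \<in> ?V - C" "(j, Suc k) \<in> ?V - C"
      show "j \<le> i"
      proof (rule ccontr)
        assume "\<not> j \<le> i"
        then have "edge (i, k) (j, Suc k)" by (simp add: edge_def)
        then have "((i, k), (j, Suc k)) \<in> E \<or> ((j, Suc k), (i, k)) \<in> E"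
          using ij by (cases "even k") (simp_all add: E_def L_def R_def)
        then show False using C(2) ij by (auto simp: vertex_cover_def)
      qed
    qed
    have "I.cover = C" unfolding I.cover_def using C(1) V by auto
    then show "t \<le> sum (Poly_Mapping.lookup (lead_mon f)) C"
      using I.lead_mon_cover_degree[OF f fp] by simp
  qed
  then obtain es \<rho> where es: "length es = t" "set es \<subseteq> E"
    and \<rho>: "lead_mon f = \<rho> + (\<Sum>(u, v)\<leftarrow>es. Poly_Mapping.single u 1 + Poly_Mapping.single v 1)" by blast
  define ps :: "'k mpoly list" where
    "ps = map (\<lambda>(u, v). monom_poly (Poly_Mapping.single u 1 + Poly_Mapping.single v 1)) es"
  have lm: "monom_poly (lead_mon f) = monom_poly \<rho> * prod_list ps"
    unfolding \<rho> monom_poly_add[of \<rho>] monom_poly_sum_list ps_def by (simp add: comp_def case_prod_unfold)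
  \<comment> \<open>The cofactor divides the leading monomial of \<open>f\<close>, hence involves
    only variables of \<open>polyring m n\<close>.\<close>
  have "Poly_Mapping.keys \<rho> \<subseteq> Poly_Mapping.keys (lead_mon f)"
    unfolding \<rho> keys_add_nat by blast
  then have \<rho>_mem: "(monom_poly \<rho> :: 'k mpoly) \<in> polyring m n"
    using fp lead_mon_in_keys[OF f(2)] by (simp add: monom_poly_def polyring_def) blast
  have edge_mem: "monom_poly (Poly_Mapping.single u 1 + Poly_Mapping.single v 1) \<in> ?I"
    if uv: "edge u v" "u \<in> ?V" "v \<in> ?V" for u v
  proof -
    obtain i k j where ij: "u = (i, k)" "v = (j, Suc k)" "i < j"
      using uv(1) by (cases u, cases v) (simp add: edge_def)
    let ?p = "minor2 i j k (Suc k) :: 'k mpoly"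
    have "1 \<le> i \<and> i < j \<and> j \<le> m \<and> 1 \<le> k \<and> k \<le> n - 1" using uv ij by auto
    then have "?p \<in> J_KmPn m n"
      unfolding J_KmPn_def Suc_eq_plus1 by (intro ideal_gen_base) blast
    moreover have "lead_mon ?p = Poly_Mapping.single u 1 + Poly_Mapping.single v 1" "?p \<noteq> 0"
      using lead_mon_minor2[of i j k "Suc k"] ij by simp_all
    ultimately show ?thesis
      unfolding init_ideal_def by (intro ideal_gen_base) (metis (mono_tags, lifting) mem_Collect_eq)
  qed
  have "set ps \<subseteq> ?I"
  proof
    fix p assume "p \<in> set ps"
    then obtain u v where uv: "(u, v) \<in> E" "p = monom_poly (Poly_Mapping.single u 1 + Poly_Mapping.single v 1)"
      using es(2) by (auto simp: ps_def)
    have "u \<in> ?V" "v \<in> ?V" "edge u v \<or> edge v u" using uv(1) by (auto simp: E_def L_def R_def)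
    then show "p \<in> ?I"
      using edge_mem[of u v] edge_mem[of v u] unfolding uv(2) by (auto simp: add.commute)
  qed
  moreover have "length ps = t" by (simp add: ps_def es(1))
  ultimately have "prod_list ps \<in> ideal_pow (polyring m n) ?I t"
    unfolding ideal_pow_def by (intro ideal_gen_base) blast
  then show ?thesis
    unfolding lm ideal_pow_def by (rule ideal_gen_smult) (rule \<rho>_mem)
qed

theorem theorem3p5:
  fixes m n t :: nat
  assumes "m \<ge> 2" and "n \<ge> 2" and "t \<ge> 1"
  shows "ideal_pow (polyring m n) (init_ideal (polyring m n) (J_KmPn m n :: 'k::field mpoly set)) t
       = init_ideal (polyring m n) (ideal_pow (polyring m n) (J_KmPn m n :: 'k mpoly set) t)"
proof
  interpret coeff_ring "polyring m n :: 'k mpoly set" by (rule polyring_coeff_ring)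
  show "ideal_pow (polyring m n) (init_ideal (polyring m n) (J_KmPn m n :: 'k mpoly set)) t
      \<subseteq> init_ideal (polyring m n) (ideal_pow (polyring m n) (J_KmPn m n) t)"
    by (rule ideal_pow_init_subset) (rule polyring_coeff_ring)
  show "init_ideal (polyring m n) (ideal_pow (polyring m n) (J_KmPn m n :: 'k mpoly set) t)
      \<subseteq> ideal_pow (polyring m n) (init_ideal (polyring m n) (J_KmPn m n)) t"
    unfolding init_ideal_def[of _ "ideal_pow _ _ _"] ideal_pow_def[of _ "init_ideal _ _"]
    by (rule ideal_gen_least) (use lead_mon_J_pow_mem in \<open>auto simp: ideal_pow_def\<close>)
qed

end
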